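(* Let $R:=(E,\rho,F)$ and $R':=(E',\rho',F')$ be two incidence structures. If $R$ has a coding into $R'$, then there exist an (order) embedding $\phi$ from $\overline{Gal(R)}$ into $\overline{Gal(R')}$ and a continuous and order-preserving map $\psi$ from a closed subspace $\mathcal{H}$ of $\overline{Gal(R')}$ onto $\overline{Gal(R)}$ such that $\psi\circ\phi$ is the identity map of $\overline{Gal(R)}$ (with $\phi$ taking its values in $\mathcal{H}$).
   Context: An incidence structure is a triple $R=(E,\rho,F)$ with $E,F$ sets and $\rho\subseteq E\times F$. For $Y\subseteq F$, $L_R(Y):=\{x\in E: x\rho y \text{ for all } y\in Y\}$. The Galois lattice of $R$ is $Gal(R):=\{L_R(Y): Y\subseteq F\}$, ordered by inclusion. A coding from $R=(E,\rho,F)$ into $R'=(E',\rho',F')$ is a pair of maps $f:E\to E'$, $g:F\to F'$ such that $x\rho y\iff f(x)\rho' g(y)$ for all $x\in E$, $y\in F$. The power set $\mathfrak{P}(E)$ is identified with $2^E$ with the product topology ($2$ discrete); $\overline{Gal(R)}$ denotes the topological closure of $Gal(R)$ in $\mathfrak{P}(E)$ (and similarly $\overline{Gal(R')}$ in $\mathfrak{P}(E')$), with the induced topology and ordered by inclusion. *)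

theory Defs
  imports "HOL-Analysis.Analysis"
begin

locale incidence_structure =
  fixes E :: "'a set" and \<rho> :: "('a \<times> 'b) set" and F :: "'b set"
  assumes incidence_subset: "\<rho> \<subseteq> E \<times> F"

text \<open>In particular the lower cone of the empty set is all of \<open>E\<close>.\<close>

definition lower_cone :: "'a set \<Rightarrow> ('a \<times> 'b) set \<Rightarrow> 'b set \<Rightarrow> 'a set" where
  "lower_cone E \<rho> Y = {x \<in> E. \<forall>y\<in>Y. (x, y) \<in> \<rho>}"

definition Gal :: "'a set \<Rightarrow> ('a \<times> 'b) set \<Rightarrow> 'b set \<Rightarrow> 'a set set" where
  "Gal E \<rho> F = {lower_cone E \<rho> Y | Y. Y \<subseteq> F}"

definition coding ::
  "'a set \<Rightarrow> ('a \<times> 'b) set \<Rightarrow> 'b set \<Rightarrow> 'c set \<Rightarrow> ('c \<times> 'd) set \<Rightarrow> 'd set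
    \<Rightarrow> ('a \<Rightarrow> 'c) \<Rightarrow> ('b \<Rightarrow> 'd) \<Rightarrow> bool" where
  "coding E \<rho> F E' \<rho>' F' f g \<longleftrightarrow>
     f \<in> E \<rightarrow> E' \<and> g \<in> F \<rightarrow> F' \<and>
     (\<forall>x\<in>E. \<forall>y\<in>F. (x, y) \<in> \<rho> \<longleftrightarrow> (f x, g y) \<in> \<rho>')"

text \<open>The topology on the power set of \<open>E\<close> is the product topology on \<open>2\<^sup>E\<close>, with \<open>2\<close>
  discrete, transported along the bijection sending a subset of \<open>E\<close> to its characteristic
  function. Points of a product over \<open>E\<close> are extensional functions, hence the restriction
  to \<open>E\<close>.\<close>

definition powerset_topology :: "'a set \<Rightarrow> 'a set topology" where
  "powerset_topology E =
     pullback_topology (Pow E) (\<lambda>X. \<lambda>x\<in>E. x \<in> X)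
       (product_topology (\<lambda>_. discrete_topology (UNIV :: bool set)) E)"

lemma topspace_powerset_topology [simp]: "topspace (powerset_topology E) = Pow E"
  by (auto simp: powerset_topology_def topspace_pullback_topology)

definition Gal_closure :: "'a set \<Rightarrow> ('a \<times> 'b) set \<Rightarrow> 'b set \<Rightarrow> 'a set set" where
  "Gal_closure E \<rho> F = powerset_topology E closure_of Gal E \<rho> F"

definition order_embedding_on :: "'a::order set \<Rightarrow> 'b::order set \<Rightarrow> ('a \<Rightarrow> 'b) \<Rightarrow> bool" where
  "order_embedding_on A B h \<longleftrightarrow>
     h \<in> A \<rightarrow> B \<and> (\<forall>x\<in>A. \<forall>y\<in>A. h x \<le> h y \<longleftrightarrow> x \<le> y)"

end

theory Submission
  imports Defs
begin

text \<open>Write \<open>cl A\<close> for the closure \<open>polar_hull E \<rho> F A\<close> of \<open>A\<close>. Since the Galois lattice is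
  closed under intersections, a set \<open>X\<close> is in its topological closure iff \<open>cl A \<subseteq> X\<close>
  for every finite \<open>A \<subseteq> X\<close>, i.e. iff \<open>X\<close> is the directed union of these \<open>cl A\<close>. For a coding
  \<open>(f, g)\<close>, the map \<open>\<psi> = f\<^sup>-\<^sup>1\<close> is continuous, monotone, and sends \<open>L'(g ` Y)\<close> to \<open>L(Y)\<close>. Lifting
  every \<open>cl A\<close> to \<open>L'(g ` A\<^sup>u)\<close>, where \<open>A\<^sup>u\<close> is the set of upper bounds of \<open>A\<close>, and taking
  the directed union over the finite \<open>A \<subseteq> X\<close> gives a monotone section \<open>\<phi>\<close> of \<open>\<psi>\<close>.\<close>

definition upper_cone :: "('a \<times> 'b) set \<Rightarrow> 'b set \<Rightarrow> 'a set \<Rightarrow> 'b set" where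
  "upper_cone \<rho> F A = {y \<in> F. \<forall>x\<in>A. (x, y) \<in> \<rho>}"

definition polar_hull :: "'a set \<Rightarrow> ('a \<times> 'b) set \<Rightarrow> 'b set \<Rightarrow> 'a set \<Rightarrow> 'a set" where
  "polar_hull E \<rho> F A = lower_cone E \<rho> (upper_cone \<rho> F A)"

lemma upper_cone_subset: "upper_cone \<rho> F A \<subseteq> F"
  by (auto simp: upper_cone_def)

lemma upper_cone_antimono: "A \<subseteq> B \<Longrightarrow> upper_cone \<rho> F B \<subseteq> upper_cone \<rho> F A"
  by (auto simp: upper_cone_def)

lemma lower_cone_subset: "lower_cone E \<rho> Y \<subseteq> E"
  by (auto simp: lower_cone_def)

lemma lower_cone_antimono: "Y \<subseteq> Z \<Longrightarrow> lower_cone E \<rho> Z \<subseteq> lower_cone E \<rho> Y"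
  by (auto simp: lower_cone_def)

lemma lower_cone_in_Gal: "Y \<subseteq> F \<Longrightarrow> lower_cone E \<rho> Y \<in> Gal E \<rho> F"
  by (auto simp: Gal_def)

lemma subset_polar_hull: "A \<subseteq> E \<Longrightarrow> A \<subseteq> polar_hull E \<rho> F A"
  by (auto simp: polar_hull_def lower_cone_def upper_cone_def)

text \<open>If \<open>G\<close> is the lower cone of \<open>Y\<close> and contains \<open>A\<close>,
  then \<open>Y\<close> lies in the upper cone of \<open>A\<close>, and lower cones reverse
  inclusion.\<close>

lemma polar_hull_least:
  assumes "G \<in> Gal E \<rho> F" "A \<subseteq> G"
  shows "polar_hull E \<rho> F A \<subseteq> G"
  using assms by (fastforce simp: Gal_def polar_hull_def lower_cone_def upper_cone_def)

lemma continuous_map_powerset_member: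
  assumes "x \<in> E"
  shows "continuous_map (powerset_topology E) (discrete_topology UNIV) (\<lambda>X. x \<in> X)"
proof -
  have "continuous_map (powerset_topology E) (discrete_topology UNIV)
      ((\<lambda>h. h x) \<circ> (\<lambda>X. \<lambda>x\<in>E. x \<in> X))"
    unfolding powerset_topology_def
    by (intro continuous_map_pullback continuous_map_product_projection assms)
  then show ?thesis
    by (rule continuous_map_eq) (simp add: assms)
qed

lemma continuous_map_powersetI:
  assumes "h \<in> topspace T \<rightarrow> Pow E"
    and "\<And>x. x \<in> E \<Longrightarrow> continuous_map T (discrete_topology UNIV) (\<lambda>z. x \<in> h z)"
  shows "continuous_map T (powerset_topology E) h"
  unfolding powerset_topology_def
proof (rule continuous_map_pullback')
  show "continuous_map T (product_topology (\<lambda>_. discrete_topology UNIV) E)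
      ((\<lambda>X. \<lambda>x\<in>E. x \<in> X) \<circ> h)"
    using assms(2) by (auto simp: continuous_map_componentwise extensional_def)
  show "topspace T \<subseteq> h -` Pow E"
    using assms(1) by auto
qed

text \<open>A basic open box around the characteristic function of \<open>X\<close> constrains only
  finitely many coordinates; these form \<open>A\<close>.\<close>

lemma openin_powerset_finite_trace:
  assumes "openin (powerset_topology E) U" "X \<in> U"
  obtains A where "finite A" "A \<subseteq> E" "\<And>Z. Z \<subseteq> E \<Longrightarrow> Z \<inter> A = X \<inter> A \<Longrightarrow> Z \<in> U"
proof -
  let ?h = "\<lambda>X. \<lambda>x\<in>E. x \<in> X"
  obtain V where V: "openin (product_topology (\<lambda>_. discrete_topology (UNIV :: bool set)) E) V"
    and U: "U = ?h -` V \<inter> Pow E"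
    using assms(1) unfolding powerset_topology_def openin_pullback_topology by blast
  have "?h X \<in> V"
    using assms(2) U by auto
  then obtain W where fin: "finite {x \<in> E. W x \<noteq> (UNIV :: bool set)}"
    and W: "?h X \<in> Pi\<^sub>E E W" "Pi\<^sub>E E W \<subseteq> V"
    using V unfolding openin_product_topology_alt by auto
  show thesis
  proof
    show "finite {x \<in> E. W x \<noteq> UNIV}" "{x \<in> E. W x \<noteq> UNIV} \<subseteq> E"
      using fin by auto
    fix Z assume Z: "Z \<subseteq> E" "Z \<inter> {x \<in> E. W x \<noteq> UNIV} = X \<inter> {x \<in> E. W x \<noteq> UNIV}"
    have "(x \<in> Z) \<in> W x" if "x \<in> E" for x
    proof (cases "W x = UNIV")
      case False
      then have "x \<in> Z \<longleftrightarrow> x \<in> X"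
        using Z that by blast
      then show ?thesis
        using W(1) that by (simp add: PiE_iff)
    qed simp
    then have "?h Z \<in> Pi\<^sub>E E W"
      by auto
    with W(2) have "?h Z \<in> V"
      by (rule subsetD)
    then show "Z \<in> U"
      using U Z(1) by auto
  qed
qed

text \<open>This replaces neighbourhoods by a finitary condition: an open set around
  \<open>X\<close> can test only finitely many memberships, so \<open>X\<close> is a limit of the
  lattice iff each finite trace of \<open>X\<close> is that of some member.\<close>

lemma Gal_closure_iff:
  "X \<in> Gal_closure E \<rho> F \<longleftrightarrow>
    X \<subseteq> E \<and> (\<forall>A. finite A \<and> A \<subseteq> X \<longrightarrow> polar_hull E \<rho> F A \<subseteq> X)"
proof (intro iffI conjI allI impI)
  assume X: "X \<in> Gal_closure E \<rho> F"
  then show XE: "X \<subseteq> E"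
    unfolding Gal_closure_def using closure_of_subset_topspace by force
  fix A assume A: "finite A \<and> A \<subseteq> X"
  show "polar_hull E \<rho> F A \<subseteq> X"
  proof
    fix x assume x: "x \<in> polar_hull E \<rho> F A"
    then have "x \<in> E"
      by (auto simp: polar_hull_def lower_cone_def)
    show "x \<in> X"
    proof (rule ccontr)
      assume "x \<notin> X"
      \<comment> \<open>A neighbourhood of \<open>X\<close> that misses the lattice: a member
        containing \<open>A\<close> contains its hull, hence \<open>x\<close>.\<close>
      let ?U = "{Z \<in> Pow E. x \<notin> Z} \<inter> (\<Inter>a\<in>A. {Z \<in> Pow E. a \<in> Z})"
      have member: "openin (powerset_topology E) {Z \<in> Pow E. (z \<in> Z) \<in> P}"
        if "z \<in> E" for z P
        using openin_continuous_map_preimage[OF continuous_map_powerset_member[OF that], of P]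
        by simp
      have "openin (powerset_topology E) {Z \<in> Pow E. x \<notin> Z}"
        using member[OF \<open>x \<in> E\<close>, of "{False}"] by simp
      moreover have "openin (powerset_topology E) {Z \<in> Pow E. a \<in> Z}" if "a \<in> A" for a
        using member[of a "{True}"] that A XE by auto
      ultimately have "openin (powerset_topology E) ?U"
        \<comment> \<open>For empty \<open>A\<close> the intersection is \<open>UNIV\<close>, which
          is not a set of subsets of \<open>E\<close> only, so \<open>openin_INT2\<close> does not
          apply.\<close>
        using A by (cases "A = {}") (simp_all add: openin_Int openin_INT2)
      moreover from X have "\<forall>U. X \<in> U \<and> openin (powerset_topology E) U \<longrightarrow>
          (\<exists>G. G \<in> Gal E \<rho> F \<and> G \<in> U)"
        unfolding Gal_closure_def in_closure_of by (rule conjunct2)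
      moreover have "X \<in> ?U"
        using XE A \<open>x \<notin> X\<close> by auto
      ultimately have "\<exists>G. G \<in> Gal E \<rho> F \<and> G \<in> ?U"
        by (elim allE[of _ ?U] mp) (rule conjI)
      then obtain G where "G \<in> Gal E \<rho> F" "x \<notin> G" "A \<subseteq> G"
        by auto
      then show False
        using polar_hull_least[of G E \<rho> F A] x by blast
    qed
  qed
next
  assume X: "X \<subseteq> E \<and> (\<forall>A. finite A \<and> A \<subseteq> X \<longrightarrow> polar_hull E \<rho> F A \<subseteq> X)"
  show "X \<in> Gal_closure E \<rho> F"
    unfolding Gal_closure_def in_closure_of
  proof (intro conjI allI impI)
    fix U assume "X \<in> U \<and> openin (powerset_topology E) U"
    then obtain A where A: "finite A" "A \<subseteq> E"
      and U: "\<And>Z. Z \<subseteq> E \<Longrightarrow> Z \<inter> A = X \<inter> A \<Longrightarrow> Z \<in> U"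
      using openin_powerset_finite_trace by metis
    \<comment> \<open>This member of the lattice lies between \<open>X \<inter> A\<close> and
      \<open>X\<close>, so it has the same trace on \<open>A\<close> as \<open>X\<close>.\<close>
    let ?G = "polar_hull E \<rho> F (X \<inter> A)"
    have "?G \<subseteq> X"
      using X A by blast
    moreover have "X \<inter> A \<subseteq> ?G"
      using A by (intro subset_polar_hull) blast
    ultimately have "?G \<in> U"
      using X by (intro U) auto
    then show "\<exists>Z. Z \<in> Gal E \<rho> F \<and> Z \<in> U"
      unfolding polar_hull_def using lower_cone_in_Gal upper_cone_subset by metis
  qed (use X in simp)
qed

text \<open>By directedness a finite subset of the union already lies in one member, which then
  contains its hull.\<close>

lemma directed_Union_in_Gal_closure:
  assumes "\<G> \<subseteq> Gal E \<rho> F" "\<G> \<noteq> {}"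
    and directed: "\<And>G H. G \<in> \<G> \<Longrightarrow> H \<in> \<G> \<Longrightarrow> \<exists>K\<in>\<G>. G \<union> H \<subseteq> K"
  shows "\<Union>\<G> \<in> Gal_closure E \<rho> F"
  unfolding Gal_closure_iff
proof (intro conjI allI impI)
  show "\<Union>\<G> \<subseteq> E"
    using assms(1) by (auto simp: Gal_def lower_cone_def)
  fix A assume "finite A \<and> A \<subseteq> \<Union>\<G>"
  then have "finite A" "A \<subseteq> \<Union>\<G>"
    by auto
  then have "\<exists>G\<in>\<G>. A \<subseteq> G"
  proof (induction A rule: finite_induct)
    case empty
    then show ?case using assms(2) by auto
  next
    case (insert a A)
    then obtain G H where "G \<in> \<G>" "A \<subseteq> G" "H \<in> \<G>" "a \<in> H"
      by auto
    with directed[of G H] show ?case by blast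
  qed
  then obtain G where "G \<in> \<G>" "A \<subseteq> G"
    by blast
  then show "polar_hull E \<rho> F A \<subseteq> \<Union>\<G>"
    using polar_hull_least[of G E \<rho> F A] assms(1) by blast
qed

lemma coding_vimage_lower_cone:
  assumes "coding E \<rho> F E' \<rho>' F' f g" "Y \<subseteq> F"
  shows "{x \<in> E. f x \<in> lower_cone E' \<rho>' (g ` Y)} = lower_cone E \<rho> Y"
  using assms unfolding coding_def lower_cone_def by blast

theorem theorem7:
  fixes E :: "'a set" and \<rho> :: "('a \<times> 'b) set" and F :: "'b set"
    and E' :: "'c set" and \<rho>' :: "('c \<times> 'd) set" and F' :: "'d set"
  assumes "incidence_structure E \<rho> F"
    and "incidence_structure E' \<rho>' F'"
    and "\<exists>f g. coding E \<rho> F E' \<rho>' F' f g"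
  shows "\<exists>\<phi> \<psi> \<H>.
      order_embedding_on (Gal_closure E \<rho> F) (Gal_closure E' \<rho>' F') \<phi> \<and>
      closedin (subtopology (powerset_topology E') (Gal_closure E' \<rho>' F')) \<H> \<and>
      continuous_map (subtopology (powerset_topology E') \<H>)
        (subtopology (powerset_topology E) (Gal_closure E \<rho> F)) \<psi> \<and>
      mono_on \<H> \<psi> \<and>
      \<psi> ` \<H> = Gal_closure E \<rho> F \<and>
      \<phi> ` Gal_closure E \<rho> F \<subseteq> \<H> \<and>
      (\<forall>X\<in>Gal_closure E \<rho> F. \<psi> (\<phi> X) = X)"
proof -
  obtain f g where fg: "coding E \<rho> F E' \<rho>' F' f g"
    using assms(3) by blast
  then have f: "f \<in> E \<rightarrow> E'" and g: "g \<in> F \<rightarrow> F'"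
    by (auto simp: coding_def)
  let ?C = "Gal_closure E \<rho> F" and ?C' = "Gal_closure E' \<rho>' F'"
  define \<psi> where "\<psi> X = {x \<in> E. f x \<in> X}" for X
  define \<H> where "\<H> = {X \<in> ?C'. \<psi> X \<in> ?C}"
  define lift where "lift A = lower_cone E' \<rho>' (g ` upper_cone \<rho> F A)" for A
  \<comment> \<open>\<open>lift X\<close> itself would not do: its image under \<psi> is the hull of
    \<open>X\<close>, which may exceed \<open>X\<close> when \<open>X\<close> is only a limit of the
    lattice.\<close>
  define \<phi> where "\<phi> X = \<Union> (lift ` {A. finite A \<and> A \<subseteq> X})" for X
  have \<psi>_lift: "\<psi> (lift A) = polar_hull E \<rho> F A" for A
    unfolding \<psi>_def lift_def polar_hull_def
    using coding_vimage_lower_cone[OF fg upper_cone_subset] .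
  have lift_mono: "lift A \<subseteq> lift B" if "A \<subseteq> B" for A B
    unfolding lift_def using that
    by (intro lower_cone_antimono image_mono upper_cone_antimono)
  have lift_Gal: "lift A \<in> Gal E' \<rho>' F'" for A
    unfolding lift_def using g upper_cone_subset[of \<rho> F A]
    by (intro lower_cone_in_Gal) auto
  have \<phi>_C': "\<phi> X \<in> ?C'" for X
    unfolding \<phi>_def
  proof (rule directed_Union_in_Gal_closure)
    fix G H assume "G \<in> lift ` {A. finite A \<and> A \<subseteq> X}" "H \<in> lift ` {A. finite A \<and> A \<subseteq> X}"
    then obtain A B where "finite A" "A \<subseteq> X" "G = lift A" "finite B" "B \<subseteq> X" "H = lift B"
      by auto
    \<comment> \<open>Finite subsets of \<open>X\<close> are closed under binary union, and
      \<open>lift\<close> is monotone.\<close>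
    then show "\<exists>K\<in>lift ` {A. finite A \<and> A \<subseteq> X}. G \<union> H \<subseteq> K"
      using lift_mono[of A "A \<union> B"] lift_mono[of B "A \<union> B"]
      by (intro bexI[of _ "lift (A \<union> B)"]) auto
  qed (use lift_Gal in auto)
  have \<psi>\<phi>: "\<psi> (\<phi> X) = X" if X: "X \<in> ?C" for X
  proof -
    \<comment> \<open>Preimages commute with unions.\<close>
    have "\<psi> (\<phi> X) = (\<Union>A\<in>{A. finite A \<and> A \<subseteq> X}. \<psi> (lift A))"
      by (auto simp: \<psi>_def \<phi>_def)
    also have "\<dots> = (\<Union>A\<in>{A. finite A \<and> A \<subseteq> X}. polar_hull E \<rho> F A)"
      by (simp add: \<psi>_lift)
    also have "\<dots> = X"
    proof
      show "(\<Union>A\<in>{A. finite A \<and> A \<subseteq> X}. polar_hull E \<rho> F A) \<subseteq> X"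
        using X by (auto simp: Gal_closure_iff)
      have "x \<in> polar_hull E \<rho> F {x}" if "x \<in> X" for x
        using subset_polar_hull[of "{x}" E \<rho> F] that X by (auto simp: Gal_closure_iff)
      then show "X \<subseteq> (\<Union>A\<in>{A. finite A \<and> A \<subseteq> X}. polar_hull E \<rho> F A)"
        by blast
    qed
    finally show ?thesis .
  qed
  have \<phi>_mono: "\<phi> X \<subseteq> \<phi> Y" if "X \<subseteq> Y" for X Y
    unfolding \<phi>_def using that by blast
  have \<psi>_mono: "\<psi> X \<subseteq> \<psi> Y" if "X \<subseteq> Y" for X Y
    unfolding \<psi>_def using that by blast
  have \<psi>_cont: "continuous_map (powerset_topology E') (powerset_topology E) \<psi>"
  proof (rule continuous_map_powersetI)
    fix x assume "x \<in> E"
    \<comment> \<open>The coordinate of \<open>\<psi> X\<close> at \<open>x\<close> is the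
      coordinate of \<open>X\<close> at \<open>f x\<close>.\<close>
    then show "continuous_map (powerset_topology E') (discrete_topology UNIV) (\<lambda>X. x \<in> \<psi> X)"
      using continuous_map_powerset_member[of "f x" E'] f by (auto simp: \<psi>_def)
  qed (auto simp: \<psi>_def)
  have C'_Pow: "?C' \<subseteq> Pow E'"
    by (auto simp: Gal_closure_iff)
  have "closedin (powerset_topology E) ?C"
    by (simp add: Gal_closure_def)
  then have "closedin (subtopology (powerset_topology E') ?C')
      {X \<in> topspace (subtopology (powerset_topology E') ?C'). \<psi> X \<in> ?C}"
    by (rule closedin_continuous_map_preimage[OF continuous_map_from_subtopology[OF \<psi>_cont]])
  moreover have "topspace (subtopology (powerset_topology E') ?C') = ?C'"
    using C'_Pow by auto
  ultimately have closed: "closedin (subtopology (powerset_topology E') ?C') \<H>"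
    by (simp only: \<H>_def)
  have \<phi>_H: "\<phi> ` ?C \<subseteq> \<H>"
    using \<phi>_C' \<psi>\<phi> by (auto simp: \<H>_def)
  have \<psi>_H: "\<psi> ` \<H> = ?C"
  proof
    show "\<psi> ` \<H> \<subseteq> ?C"
      by (auto simp: \<H>_def)
    show "?C \<subseteq> \<psi> ` \<H>"
      using \<phi>_H \<psi>\<phi> by (metis image_subset_iff imageI subsetI)
  qed
  \<comment> \<open>A monotone map with a monotone left inverse reflects the order.\<close>
  have "\<phi> X \<subseteq> \<phi> Y \<longleftrightarrow> X \<subseteq> Y" if "X \<in> ?C" "Y \<in> ?C" for X Y
    using \<phi>_mono[of X Y] \<psi>_mono[of "\<phi> X" "\<phi> Y"] \<psi>\<phi> that by auto
  then have "order_embedding_on ?C ?C' \<phi>"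
    unfolding order_embedding_on_def using \<phi>_C' by blast
  moreover have "continuous_map (subtopology (powerset_topology E') \<H>)
      (subtopology (powerset_topology E) ?C) \<psi>"
    using continuous_map_from_subtopology[OF \<psi>_cont] \<psi>_H
    unfolding continuous_map_in_subtopology by auto
  moreover have "mono_on \<H> \<psi>"
    using \<psi>_mono by (intro monotone_onI)
  ultimately show ?thesis
    using closed \<psi>_H \<phi>_H \<psi>\<phi> by blast
qed

end
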